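(* Let $a,b,c$ be positive integers such that $a^{2}+b^{2}=c^{2}$. Then $p(a,3)+p(b,3)=p(c,3)$.
   Context: For a natural number $n$, $p(n,3)$ denotes the number of integer partitions of $n$ into exactly three parts, i.e. the number of triples of integers $(n_1,n_2,n_3)$ with $n_1\geq n_2\geq n_3\geq 1$ and $n_1+n_2+n_3=n$. The Pythagorean triple $\{a,b,c\}$ is not required to be primitive. *)

theory Defs
  imports Main
begin

definition partitions3 :: "nat \<Rightarrow> (nat \<times> nat \<times> nat) set" where
  "partitions3 n =
     {(n1, n2, n3). n1 \<ge> n2 \<and> n2 \<ge> n3 \<and> n3 \<ge> 1 \<and> n1 + n2 + n3 = n}"

definition p3 :: "nat \<Rightarrow> nat" where
  "p3 n = card (partitions3 n)"

lemma finite_partitions3: "finite (partitions3 n)"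
proof (rule finite_subset)
  show "partitions3 n \<subseteq> {..n} \<times> {..n} \<times> {..n}"
    by (auto simp: partitions3_def)
qed simp

end

theory Submission
  imports Defs
begin

text \<open>
  The number of partitions of \<open>n\<close> into three parts is \<open>n\<^sup>2 / 12\<close> rounded to the nearest integer.
  What matters is the shape of the rounding error: it splits into a term that depends on \<open>n\<^sup>2\<close>
  modulo 3 and one that depends on \<open>n\<^sup>2\<close> modulo 4,
  \<open>12 * p3 n = n\<^sup>2 - 4 * (n\<^sup>2 mod 3) + 3 * (n\<^sup>2 mod 4)\<close>
  (lemma \<open>p3_closed_form\<close>, which follows from the recursion \<open>p3_add_3\<close>).
  If \<open>a\<^sup>2 + b\<^sup>2 = c\<^sup>2\<close>, then all three terms are additive. Squares are 0 or 1 modulo 3 and modulo 4,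
  so the two residues on the left add up to at most 2; the value 2 would force \<open>c\<^sup>2\<close> to have the
  residue 2, which is not a square in either modulus. Hence no reduction happens in the sum of the
  residues.
\<close>

text \<open>
  The partitions with smallest part at least 2 correspond to those of \<open>n\<close> by removing 1 from
  each part; those with smallest part 1 are determined by the middle part.
\<close>

lemma p3_add_3: "p3 (n + 3) = p3 n + (n + 2) div 2"
proof -
  define up :: "nat \<times> nat \<times> nat \<Rightarrow> nat \<times> nat \<times> nat"
    where "up = (\<lambda>(x, y, z). (x + 1, y + 1, z + 1))"
  define one :: "nat \<Rightarrow> nat \<times> nat \<times> nat" where "one = (\<lambda>k. (n + 2 - k, k, 1))"
  let ?K = "{1..(n + 2) div 2}"
  have split: "partitions3 (n + 3) = up ` partitions3 n \<union> one ` ?K" (is "?L = ?R")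
  proof (rule set_eqI)
    fix t :: "nat \<times> nat \<times> nat"
    obtain x y z where t: "t = (x, y, z)" by (cases t)
    show "t \<in> ?L \<longleftrightarrow> t \<in> ?R"
    proof
      assume L: "t \<in> ?L"
      show "t \<in> ?R"
      proof (cases "z = 1")
        case True
        with L have "y \<in> ?K" "t = one y"
          by (auto simp: t partitions3_def one_def)
        then show ?thesis by blast
      next
        case False
        with L have "(x - 1, y - 1, z - 1) \<in> partitions3 n"
          and "t = up (x - 1, y - 1, z - 1)"
          by (auto simp: t partitions3_def up_def)
        then show ?thesis by blast
      qed
    qed (auto simp: partitions3_def up_def one_def)
  qed
  have "inj_on up (partitions3 n)"
    by (auto simp: inj_on_def up_def)
  moreover have "inj_on one ?K"
    by (auto simp: inj_on_def one_def)
  moreover have "up ` partitions3 n \<inter> one ` ?K = {}"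
    by (auto simp: partitions3_def up_def one_def)
  ultimately show ?thesis
    unfolding p3_def split by (simp add: card_Un_disjoint finite_partitions3 card_image)
qed

lemma p3_eq_0:
  assumes "n < 3"
  shows "p3 n = 0"
proof -
  have "partitions3 n = {}"
    using assms by (auto simp: partitions3_def)
  then show ?thesis by (simp add: p3_def)
qed

lemma square_mod_3: "(n::nat)\<^sup>2 mod 3 = (if 3 dvd n then 0 else 1)"
proof -
  have "n mod 3 = 0 \<or> n mod 3 = 1 \<or> n mod 3 = 2" by linarith
  moreover have "n\<^sup>2 mod 3 = (n mod 3)\<^sup>2 mod 3"
    by (rule power_mod [symmetric])
  ultimately show ?thesis
    by (elim disjE) (simp_all only: dvd_eq_mod_eq_0, simp_all)
qed

lemma square_mod_4: "(n::nat)\<^sup>2 mod 4 = (if even n then 0 else 1)"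
proof (cases "even n")
  case True
  then obtain k where "n = 2 * k" by (elim evenE)
  then show ?thesis by (simp add: power_mult_distrib)
next
  case False
  then obtain k where "n = 2 * k + 1" by (elim oddE)
  then have "n\<^sup>2 = 1 + 4 * (k\<^sup>2 + k)"
    by (simp add: power2_eq_square algebra_simps)
  then have "n\<^sup>2 mod 4 = 1" by (simp only: mod_mult_self2) simp
  with False show ?thesis by simp
qed

text \<open>The subtracted term is moved to the left because subtraction on \<open>nat\<close> truncates.\<close>

lemma p3_closed_form: "12 * p3 n + 4 * (n\<^sup>2 mod 3) = n\<^sup>2 + 3 * (n\<^sup>2 mod 4)"
proof (induction n rule: less_induct)
  case (less n)
  show ?case
  proof (cases "n < 3")
    case True
    then have "n = 0 \<or> n = 1 \<or> n = 2" by linarith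
    then show ?thesis by (auto simp: p3_eq_0)
  next
    case False
    then obtain m where n: "n = m + 3"
      by (metis add.commute le_Suc_ex not_less)
    have IH: "12 * p3 m + 4 * (m\<^sup>2 mod 3) = m\<^sup>2 + 3 * (m\<^sup>2 mod 4)"
      by (rule less.IH) (simp add: n)
    have "n\<^sup>2 = m\<^sup>2 + 6 * m + 9"
      by (simp add: n power2_eq_square algebra_simps)
    moreover have "n\<^sup>2 mod 3 = m\<^sup>2 mod 3"
      by (simp add: n square_mod_3)
    moreover have "12 * ((m + 2) div 2) + 3 * (m\<^sup>2 mod 4) = 6 * m + 9 + 3 * (n\<^sup>2 mod 4)"
      by (cases "even m") (auto simp: n square_mod_4 elim!: evenE oddE)
    moreover have "p3 n = p3 m + (m + 2) div 2"
      by (simp only: n p3_add_3)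
    ultimately show ?thesis
      using IH by linarith
  qed
qed

lemma pythagorean_mod_3_additive:
  fixes a b c :: nat
  assumes "a\<^sup>2 + b\<^sup>2 = c\<^sup>2"
  shows "a\<^sup>2 mod 3 + b\<^sup>2 mod 3 = c\<^sup>2 mod 3"
proof -
  have "(a\<^sup>2 mod 3 + b\<^sup>2 mod 3) mod 3 = c\<^sup>2 mod 3"
    using assms by (simp add: mod_add_eq)
  then show ?thesis
    by (simp add: square_mod_3 split: if_splits)
qed

lemma pythagorean_mod_4_additive:
  fixes a b c :: nat
  assumes "a\<^sup>2 + b\<^sup>2 = c\<^sup>2"
  shows "a\<^sup>2 mod 4 + b\<^sup>2 mod 4 = c\<^sup>2 mod 4"
proof -
  have "(a\<^sup>2 mod 4 + b\<^sup>2 mod 4) mod 4 = c\<^sup>2 mod 4"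
    using assms by (simp add: mod_add_eq)
  then show ?thesis
    by (simp add: square_mod_4 split: if_splits)
qed

theorem mainTheorem1:
  fixes a b c :: nat
  assumes "a > 0" and "b > 0" and "c > 0"
    and "a\<^sup>2 + b\<^sup>2 = c\<^sup>2"
  shows "p3 a + p3 b = p3 c"
  using p3_closed_form [of a] p3_closed_form [of b] p3_closed_form [of c]
    pythagorean_mod_3_additive [OF assms(4)] pythagorean_mod_4_additive [OF assms(4)] assms(4)
  by linarith

end
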